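(* Let $a$ be a non-zero integer and let $n$ be a positive integer. The triangular number $T_n$ can be a member of a $D(a)$-pair $\{T_n,T_m\}$, $m\ge 1$, only if every prime factor of $n(n+1)$ belongs to the set consisting of: the prime $2$, the prime divisors of $a$, and the odd primes $p$ for which $a$ is a quadratic residue modulo $p$.
   Context: For a positive integer $n$, $T_n=\frac{n(n+1)}{2}$ denotes the $n$-th triangular number. For a non-zero integer $a$, a $D(a)$-pair is a set of two distinct positive integers whose product increased by $a$ is a perfect square. *)

theory Defs
  imports
    "HOL-Number_Theory.Number_Theory"
    "HOL-Computational_Algebra.Nth_Powers"
    "HOL-Library.Nat_Bijection"
begin

definition D_pair :: "int \<Rightarrow> nat set \<Rightarrow> bool" where
  "D_pair a S \<longleftrightarrow>
     (\<exists>x y. S = {x, y} \<and> x \<noteq> y \<and> x > 0 \<and> y > 0 \<and> is_square (int x * int y + a))"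

end

theory Submission
  imports Defs
begin

text \<open>
  If \<open>p\<close> is an odd prime dividing \<open>n(n+1) = 2 T\<^sub>n\<close>, then \<open>p\<close> already divides \<open>T\<^sub>n\<close>.
  Reducing \<open>T\<^sub>n T\<^sub>m + a = k\<^sup>2\<close> modulo \<open>p\<close> therefore leaves \<open>a \<equiv> k\<^sup>2\<close>, so \<open>a\<close> is a square
  modulo \<open>p\<close>. Since \<open>QuadRes\<close> admits the residue 0, this covers the case \<open>p dvd a\<close> as well.
\<close>

lemma D_pair_doubletonD:
  assumes "D_pair a {u, v}"
  shows "is_square (int u * int v + a)"
  using assms unfolding D_pair_def by (auto simp: doubleton_eq_iff mult.commute)

text \<open>The factor 2 in \<open>n(n+1) = 2 T\<^sub>n\<close> is a unit modulo an odd prime.\<close>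

lemma odd_prime_dvd_triangle:
  assumes "prime p" "odd p" "p dvd n * (n + 1)"
  shows "p dvd triangle n"
proof -
  have "n * (n + 1) = 2 * triangle n"
    by (simp add: triangle_def)
  moreover have "coprime p 2"
    using \<open>odd p\<close> by simp
  ultimately show ?thesis
    using assms(3) by (simp add: coprime_dvd_mult_right_iff)
qed

lemma QuadRes_if_square_add_multiple:
  assumes "is_square (x + a)" "p dvd x"
  shows "QuadRes p a"
proof -
  obtain k where "x + a = k\<^sup>2"
    using assms(1) by (auto elim: is_nth_powerE)
  then have "[k\<^sup>2 = a] (mod p)"
    using assms(2) by (metis add_diff_cancel_right' cong_iff_dvd_diff)
  then show ?thesis
    by (auto simp: QuadRes_def)
qed

theorem theorem9:
  fixes a :: int and n :: nat
  assumes "a \<noteq> 0" and "n \<ge> 1"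
    and "\<exists>m\<ge>1. D_pair a {triangle n, triangle m}"
  shows "prime_factors (n * (n + 1)) \<subseteq>
           {2} \<union> {p. prime p \<and> int p dvd a} \<union> {p. prime p \<and> odd p \<and> QuadRes (int p) a}"
proof
  fix p assume "p \<in> prime_factors (n * (n + 1))"
  then have p: "prime p" "p dvd n * (n + 1)"
    by (auto simp: in_prime_factors_iff)
  obtain m where "D_pair a {triangle n, triangle m}"
    using assms(3) by blast
  then have square: "is_square (int (triangle n) * int (triangle m) + a)"
    by (rule D_pair_doubletonD)
  show "p \<in> {2} \<union> {p. prime p \<and> int p dvd a} \<union> {p. prime p \<and> odd p \<and> QuadRes (int p) a}"
  proof (cases "p = 2")
    case False
    then have "odd p"
      using p(1) primes_dvd_imp_eq two_is_prime_nat by blast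
    then have "int p dvd int (triangle n) * int (triangle m)"
      using odd_prime_dvd_triangle p by simp
    then show ?thesis
      using QuadRes_if_square_add_multiple[OF square] p(1) \<open>odd p\<close> by simp
  qed simp
qed

end
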